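(* For the evacuation problem on the line with $n_s\ge 2$ senders and exactly one receiver ($n_r=1$), there exists an evacuation algorithm $\mathcal{A}$ with $\mathrm{CR}(\mathcal{A})<5.681319$. More exactly, \[\mathrm{CR}(\mathcal{A})\le 1+\frac{1+v_r}{1-v_r}\left(\frac{1+4v_r-v_r^2}{v_r(3-v_r)}\right),\] where $v_r$ is the root of $v_r^4-16v_r^3+26v_r^2+8v_r-3=0$ satisfying $0\le v_r<1$.
   Context: Evacuation problem on the line: $n\ge 2$ agents start at time $0$ at the origin of the real line. Each agent can move in either direction with any speed at most $1$, changing speed and direction instantaneously and arbitrarily often. A target (exit) is at an unknown point $x\in\mathbb{R}$ with $|x|>1$; an agent detects the target when it visits its location. Co-located agents can always exchange information (face-to-face communication). Each agent is either a sender (can transmit messages wirelessly to all other agents at any distance, but can receive messages only face-to-face) or a receiver (can receive wireless messages from any distance, but can transmit only face-to-face); there are $n_s$ senders and $n_r=n-n_s$ receivers. The types of all agents and the algorithm are known to all agents in advance. An evacuation algorithm $\mathcal{A}$ prescribes the movement of every agent, both the search trajectory followed until the agent finds or is informed of the target, and its subsequent actions. $E(\mathcal{A},x)$ is the time at which the last agent reaches the target when it is at $x$, and the competitive ratio is $\mathrm{CR}(\mathcal{A})=\sup_{|x|>1}E(\mathcal{A},x)/|x|$. *)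

theory Defs
  imports "HOL-Analysis.Analysis"
begin

text \<open>
  The agents are the numbers below \<open>ns + nr\<close>; agent \<open>i\<close> is a sender if \<open>i < ns\<close> and a receiver
  if \<open>ns \<le> i < ns + nr\<close>. A trajectory gives the position at every time \<open>t \<ge> 0\<close>; moving with
  speed at most 1, with arbitrary changes of speed and direction, means being 1-Lipschitz.
\<close>

definition trajectory :: "(real \<Rightarrow> real) \<Rightarrow> bool" where
  "trajectory p \<longleftrightarrow> p 0 = 0 \<and> 1-lipschitz_on {0..} p"

text \<open>
  \<open>informed ns nr p x i t\<close>: when the agents move along \<open>p\<close> and the target is at \<open>x\<close>, agent \<open>i\<close>
  knows the target by time \<open>t\<close>. Informed agents always pass the information on as far as their
  types permit; this loses no generality, since an informed agent may still move as if it
  knew nothing.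
\<close>

inductive informed :: "nat \<Rightarrow> nat \<Rightarrow> (nat \<Rightarrow> real \<Rightarrow> real) \<Rightarrow> real \<Rightarrow> nat \<Rightarrow> real \<Rightarrow> bool"
  for ns nr :: nat and p :: "nat \<Rightarrow> real \<Rightarrow> real" and x :: real where
  detect: "\<lbrakk>i < ns + nr; 0 \<le> t; p i t = x\<rbrakk> \<Longrightarrow> informed ns nr p x i t"
| remember: "\<lbrakk>informed ns nr p x i s; s \<le> t\<rbrakk> \<Longrightarrow> informed ns nr p x i t"
| face_to_face: "\<lbrakk>informed ns nr p x j t; i < ns + nr; p i t = p j t\<rbrakk> \<Longrightarrow> informed ns nr p x i t"
| wireless: "\<lbrakk>informed ns nr p x j t; j < ns; ns \<le> i; i < ns + nr\<rbrakk> \<Longrightarrow> informed ns nr p x i t"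

text \<open>
  \<open>search A i\<close> is the trajectory that agent \<open>i\<close> follows as long as it is not informed;
  \<open>motion A x i\<close> is the trajectory that it actually follows when the target is at \<open>x\<close>. Since
  all agents know the algorithm, an informed agent can reconstruct the whole execution from
  \<open>x\<close>, so its further motion may depend on \<open>x\<close> in any way.
\<close>

record algorithm =
  search :: "nat \<Rightarrow> real \<Rightarrow> real"
  motion :: "real \<Rightarrow> nat \<Rightarrow> real \<Rightarrow> real"

definition evacuation_algorithm :: "nat \<Rightarrow> nat \<Rightarrow> algorithm \<Rightarrow> bool" where
  "evacuation_algorithm ns nr A \<longleftrightarrow>
     (\<forall>i < ns + nr. trajectory (search A i)) \<and>
     (\<forall>x. \<bar>x\<bar> > 1 \<longrightarrow> (\<forall>i < ns + nr. trajectory (motion A x i) \<and>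
        (\<forall>t \<ge> 0. \<not> informed ns nr (motion A x) x i t \<longrightarrow> motion A x i t = search A i t)))"

text \<open>The times below are \<open>\<infinity>\<close> if the target is never reached.\<close>

definition reach_time :: "(real \<Rightarrow> real) \<Rightarrow> real \<Rightarrow> ereal" where
  "reach_time q x = (INF t\<in>{t. 0 \<le> t \<and> q t = x}. ereal t)"

definition evac_time :: "nat \<Rightarrow> nat \<Rightarrow> algorithm \<Rightarrow> real \<Rightarrow> ereal" where
  "evac_time ns nr A x = (SUP i\<in>{..<ns + nr}. reach_time (motion A x i) x)"

definition competitive_ratio :: "nat \<Rightarrow> nat \<Rightarrow> algorithm \<Rightarrow> ereal" where
  "competitive_ratio ns nr A = (SUP x\<in>{x. \<bar>x\<bar> > 1}. evac_time ns nr A x / ereal \<bar>x\<bar>)"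

definition is_vr :: "real \<Rightarrow> bool" where
  "is_vr v \<longleftrightarrow> 0 \<le> v \<and> v < 1 \<and> v^4 - 16 * v^3 + 26 * v^2 + 8 * v - 3 = 0"

end

theory Submission
  imports Defs
begin

text \<open>
  Let \<open>k = (1 + v) / (1 - v)\<close>. All agents always move at full speed. The receiver zigzags in the
  cone \<open>\<bar>y\<bar> \<le> v t\<close>, turning at the times \<open>k ^ n\<close>, \<open>n\<close> an integer. One sender stays ahead of it on the
  right (any further senders travel with it), another sender on the left. Whenever the receiver turns, the sender on the other side turns
  towards it; the two meet, and the sender turns around and accompanies the receiver to its next
  turning point, from where it goes on alone. Thus the receiver, once informed by one sender, just
  continues until it is together with the other one, and then both go to the target.

  With the receiver turning at \<open>v\<close> at time 1, the right sender explores up to \<open>c - k\<close> until time \<open>k\<close>,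
  where \<open>c = (1 + 4 v - v\<^sup>2) / (1 - v)\<close>. The worst targets lie just beyond a turning point of a
  sender, where the delay ratio is \<open>k * c / (c - k)\<close>. The quartic is the numerator of the derivative
  of this ratio.
\<close>

section \<open>From search trajectories to an evacuation algorithm\<close>

text \<open>Clamping \<open>x\<close> to the interval of radius \<open>s\<close> about
  \<open>y\<close> describes unit speed from \<open>y\<close> towards \<open>x\<close>, then rest at
  \<open>x\<close>.\<close>

definition advance :: "real \<Rightarrow> real \<Rightarrow> real \<Rightarrow> real" where
  "advance x y s = max (y - s) (min (y + s) x)"

lemma advance_0 [simp]: "advance x y 0 = y"
  by (auto simp: advance_def)

lemma advance_reach: "advance x y \<bar>x - y\<bar> = x"
  by (auto simp: advance_def)

lemma advance_lipschitz: "\<bar>advance x y s - advance x y t\<bar> \<le> \<bar>s - t\<bar>"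
  by (auto simp: advance_def max_def min_def abs_if)

lemma trajectory_iff:
  "trajectory p \<longleftrightarrow> p 0 = 0 \<and> (\<forall>s\<ge>0. \<forall>t\<ge>s. \<bar>p t - p s\<bar> \<le> t - s)"
proof -
  have "\<bar>p s - p t\<bar> \<le> \<bar>s - t\<bar>" if "\<forall>s\<ge>0. \<forall>t\<ge>s. \<bar>p t - p s\<bar> \<le> t - s" "s \<ge> 0" "t \<ge> 0" for s t
    using that by (cases "s \<le> t") (fastforce simp: abs_minus_commute)+
  moreover have "\<bar>p t - p s\<bar> \<le> t - s"
    if "\<forall>s\<ge>0. \<forall>t\<ge>0. \<bar>p s - p t\<bar> \<le> \<bar>s - t\<bar>" "s \<ge> 0" "t \<ge> s" for s t
    using that(1)[rule_format, of t s] that(2,3) by auto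
  ultimately show ?thesis
    unfolding trajectory_def lipschitz_on_def dist_real_def by auto
qed

lemma trajectory_switch:
  assumes "trajectory p" "0 \<le> T"
  shows "trajectory (\<lambda>t. if t \<le> T then p t else advance x (p T) (t - T))"
  unfolding trajectory_iff
proof (intro conjI allI impI)
  show "(if 0 \<le> T then p 0 else advance x (p T) (0 - T)) = 0"
    using assms by (simp add: trajectory_iff)
next
  fix s t :: real
  assume st: "0 \<le> s" "s \<le> t"
  have p: "\<bar>p b - p a\<bar> \<le> b - a" if "0 \<le> a" "a \<le> b" for a b
    using assms(1) that by (simp add: trajectory_iff)
  have adv: "\<bar>advance x (p T) b - advance x (p T) a\<bar> \<le> \<bar>b - a\<bar>" for a b
    by (rule advance_lipschitz)
  show "\<bar>(if t \<le> T then p t else advance x (p T) (t - T))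
      - (if s \<le> T then p s else advance x (p T) (s - T))\<bar> \<le> t - s"
    using p[of s t] p[of s T] adv[of "t - T" 0] adv[of "t - T" "s - T"] st by auto
qed

lemma reach_time_le: "0 \<le> t \<Longrightarrow> q t = x \<Longrightarrow> reach_time q x \<le> ereal t"
  unfolding reach_time_def by (rule INF_lower) simp

text \<open>At \<open>tf\<close> a sender finds \<open>x\<close> and the receiver hears of it at
  once, but keeps to its search trajectory until \<open>tm\<close>, where it is together with every
  sender that was not at \<open>x\<close> at time \<open>tf\<close>. It informs them face-to-face,
  and all of them head straight for \<open>x\<close>.\<close>

lemma evacuation_from_search:
  fixes p :: "nat \<Rightarrow> real \<Rightarrow> real"
  assumes traj: "\<And>i. i < ns + 1 \<Longrightarrow> trajectory (p i)"
    and plan: "\<And>x. \<bar>x\<bar> > 1 \<Longrightarrow> \<exists>tf tm. 0 \<le> tf \<and> tf \<le> tm \<and> (\<exists>j<ns. p j tf = x) \<and>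
      (\<forall>i<ns. p i tf = x \<or> p i tm = p ns tm) \<and> tm + \<bar>x - p ns tm\<bar> \<le> C * \<bar>x\<bar>"
  shows "\<exists>A. evacuation_algorithm ns 1 A \<and> competitive_ratio ns 1 A \<le> ereal C"
proof -
  obtain tf tm where plan': "\<And>x. \<bar>x\<bar> > 1 \<Longrightarrow> 0 \<le> tf x \<and> tf x \<le> tm x \<and> (\<exists>j<ns. p j (tf x) = x) \<and>
      (\<forall>i<ns. p i (tf x) = x \<or> p i (tm x) = p ns (tm x)) \<and> tm x + \<bar>x - p ns (tm x)\<bar> \<le> C * \<bar>x\<bar>"
    using plan by metis
  \<comment> \<open>The time at which agent \<open>i\<close> leaves its search trajectory. A sender
    that is at \<open>x\<close> at time \<open>tf\<close> just stays there, since
    \<open>advance\<close> does not move from \<open>x\<close>.\<close>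
  define T where "T x i = (if i < ns \<and> p i (tf x) = x then tf x else tm x)" for x i
  define q where "q x i t = (if t \<le> T x i then p i t else advance x (p i (T x i)) (t - T x i))"
    for x i t
  define A where "A = \<lparr>search = p, motion = q\<rparr>"
  have q_eq: "q x i t = p i t" if "t \<le> T x i" for x i t
    using that by (simp add: q_def)
  have T_nonneg: "0 \<le> T x i" if "\<bar>x\<bar> > 1" for x i
    using plan'[OF that] by (auto simp: T_def)
  have informed: "informed ns 1 (q x) x i t" if x: "\<bar>x\<bar> > 1" and i: "i < ns + 1" and t: "T x i \<le> t"
    for x i t
  proof -
    have det: "informed ns 1 (q x) x j (tf x)" if "j < ns" "p j (tf x) = x" for j
      using that plan'[OF x] by (intro informed.detect) (auto simp: q_eq T_def)
    obtain j where j: "j < ns" "p j (tf x) = x"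
      using plan'[OF x] by blast
    have "informed ns 1 (q x) x ns (tf x)"
      using det[OF j] j(1) by (rule informed.wireless) auto
    hence r: "informed ns 1 (q x) x ns (tm x)"
      by (rule informed.remember) (use plan'[OF x] in auto)
    have "informed ns 1 (q x) x i (T x i)"
    proof (cases "i < ns \<and> p i (tf x) = x")
      case True
      thus ?thesis using det by (simp add: T_def)
    next
      case False
      hence "p i (tm x) = p ns (tm x)"
        using plan'[OF x] i less_Suc_eq[of i ns] by auto
      hence "informed ns 1 (q x) x i (tm x)"
        using False i by (intro informed.face_to_face[OF r]) (auto simp: q_eq T_def)
      thus ?thesis unfolding T_def if_not_P[OF False] .
    qed
    thus ?thesis using t by (rule informed.remember)
  qed
  have alg: "evacuation_algorithm ns 1 A"
    unfolding evacuation_algorithm_def A_def algorithm.simps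
  proof (intro conjI allI impI)
    fix x i assume "\<bar>x\<bar> > (1::real)" "i < ns + 1"
    thus "trajectory (q x i)"
      unfolding q_def using traj T_nonneg by (intro trajectory_switch) auto
  next
    fix x t :: real and i assume "\<bar>x\<bar> > 1" "i < ns + 1" "\<not> informed ns 1 (q x) x i t"
    thus "q x i t = p i t" using informed[of x i t] q_eq[of t x i] by linarith
  qed (use traj in auto)
  have "reach_time (q x i) x \<le> ereal (C * \<bar>x\<bar>)" if x: "\<bar>x\<bar> > 1" and i: "i < ns + 1" for x i
  proof (cases "i < ns \<and> p i (tf x) = x")
    case True
    hence "reach_time (q x i) x \<le> ereal (tf x)"
      using plan'[OF x] by (intro reach_time_le) (auto simp: q_eq T_def)
    also have "\<dots> \<le> ereal (C * \<bar>x\<bar>)"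
      unfolding ereal_less_eq using plan'[OF x] abs_ge_zero[of "x - p ns (tm x)"] by linarith
    finally show ?thesis .
  next
    case False
    have eq: "p i (tm x) = p ns (tm x)"
      using False plan'[OF x] i less_Suc_eq[of i ns] by auto
    have "q x i (tm x + \<bar>x - p ns (tm x)\<bar>) = x"
      using False eq advance_reach[of x "p ns (tm x)"] by (auto simp: q_def T_def)
    hence "reach_time (q x i) x \<le> ereal (tm x + \<bar>x - p ns (tm x)\<bar>)"
      using plan'[OF x] by (intro reach_time_le) auto
    also have "\<dots> \<le> ereal (C * \<bar>x\<bar>)"
      using plan'[OF x] by simp
    finally show ?thesis .
  qed
  hence time: "evac_time ns 1 A x \<le> ereal (C * \<bar>x\<bar>)" if "\<bar>x\<bar> > 1" for x
    using that by (auto simp: evac_time_def A_def intro!: SUP_least)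
  have "evac_time ns 1 A x / ereal \<bar>x\<bar> \<le> ereal C" if "\<bar>x\<bar> > 1" for x
    using time[OF that] that by (subst ereal_divide_le_pos) (auto simp: mult.commute)
  hence "competitive_ratio ns 1 A \<le> ereal C"
    unfolding competitive_ratio_def by (intro SUP_least) auto
  thus ?thesis using alg by blast
qed

section \<open>Self-similar sawtooth trajectories\<close>

definition tent :: "real \<Rightarrow> real \<Rightarrow> real \<Rightarrow> int \<Rightarrow> real \<Rightarrow> real" where
  "tent K a c n t = min (t - a * K powi n) (c * K powi n - t)"

text \<open>The turning times accumulate at 0, so the curve has no first turn to start a recursion
  from. As a supremum of 1-Lipschitz tents that are permuted by scaling with powers of
  \<open>K\<close>, it is 1-Lipschitz and self-similar at once.\<close>

definition sawtooth :: "real \<Rightarrow> real \<Rightarrow> real \<Rightarrow> real \<Rightarrow> real" where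
  "sawtooth K a c t = (SUP n. tent K a c n t)"

context
  fixes K a c :: real
  assumes K: "K > 1" and a: "a > 0"
begin

lemma tent_le: "tent K a c n t \<le> t"
proof -
  have "0 \<le> a * K powi n" using K a by simp
  thus ?thesis unfolding tent_def by linarith
qed

lemma tent_le_sawtooth: "tent K a c n t \<le> sawtooth K a c t"
  unfolding sawtooth_def by (rule cSUP_upper) (auto intro!: bdd_aboveI2[where M = t] tent_le)

lemma sawtooth_le: "(\<And>n. tent K a c n t \<le> b) \<Longrightarrow> sawtooth K a c t \<le> b"
  unfolding sawtooth_def by (rule cSUP_least) auto

lemma sawtooth_scale: "sawtooth K a c (K powi m * t) = K powi m * sawtooth K a c t"
proof -
  have le: "sawtooth K a c (K powi m * t) \<le> K powi m * sawtooth K a c t" for m t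
  proof (rule sawtooth_le)
    fix n
    have pos: "0 \<le> K powi m" using K by simp
    have "K powi n = K powi m * K powi (n - m)"
      using K by (simp flip: power_int_add)
    hence "tent K a c n (K powi m * t) = K powi m * tent K a c (n - m) t"
      using pos by (simp add: tent_def min_mult_distrib_left algebra_simps)
    also have "\<dots> \<le> K powi m * sawtooth K a c t"
      using pos by (intro mult_left_mono tent_le_sawtooth)
    finally show "tent K a c n (K powi m * t) \<le> K powi m * sawtooth K a c t" .
  qed
  have pos: "0 < K powi m" using K by simp
  have inv: "K powi (-m) * K powi m = 1"
    using K by (simp flip: power_int_add)
  have "K powi (-m) * (K powi m * t) = t"
    unfolding mult.assoc[symmetric] inv by simp
  hence "sawtooth K a c t \<le> K powi (-m) * sawtooth K a c (K powi m * t)"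
    using le[of "-m" "K powi m * t"] by metis
  hence "K powi m * sawtooth K a c t \<le> K powi m * (K powi (-m) * sawtooth K a c (K powi m * t))"
    using pos by (intro mult_left_mono) auto
  also have "\<dots> = (K powi (-m) * K powi m) * sawtooth K a c (K powi m * t)"
    by (simp only: ac_simps)
  also have "\<dots> = sawtooth K a c (K powi m * t)"
    unfolding inv by simp
  finally show ?thesis using le[of m t] by linarith
qed

lemma trajectory_sawtooth: "trajectory (sawtooth K a c)"
proof -
  have le: "sawtooth K a c s \<le> sawtooth K a c t + \<bar>t - s\<bar>" for s t
  proof (rule sawtooth_le)
    fix n
    have "tent K a c n s \<le> tent K a c n t + \<bar>t - s\<bar>"
      by (auto simp: tent_def min_def)
    thus "tent K a c n s \<le> sawtooth K a c t + \<bar>t - s\<bar>"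
      using tent_le_sawtooth[of n t] by linarith
  qed
  have "\<bar>sawtooth K a c t - sawtooth K a c s\<bar> \<le> t - s" if "s \<le> t" for s t
    using le[of s t] le[of t s] that by auto
  \<comment> \<open>Scaling by \<open>K\<close> fixes time 0 but multiplies the value there by
    \<open>K\<close>, which differs from 1.\<close>
  moreover have "sawtooth K a c 0 = 0"
    using sawtooth_scale[of 1 0] K by simp
  ultimately show ?thesis by (auto simp: trajectory_iff)
qed

text \<open>Only tents 0 and 1 matter on a period. Tent 1 peaks at time
  \<open>(a + c) / 2 * K\<close>, so \<open>c + a >= 2\<close> keeps it rising up to time
  \<open>K\<close>. By \<open>c <= (2 - a) * K\<close> the falling side of tent -1 is below tent 0
  from time 1 on.\<close>

lemma sawtooth_period:
  assumes t: "1 \<le> t" "t \<le> K" and c: "c + a \<ge> 2" "c \<le> (2 - a) * K"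
  shows "sawtooth K a c t = max (min (t - a) (c - t)) (t - a * K)"
proof (rule antisym)
  show "sawtooth K a c t \<le> max (min (t - a) (c - t)) (t - a * K)"
  proof (rule sawtooth_le)
    fix n :: int
    \<comment> \<open>The sign of \<open>c\<close> is needed to compare the falling sides of tents
      with different \<open>n\<close>.\<close>
    have cK: "c \<le> c * K" using c K mult_right_mono[of "2 - a" c K] by linarith
    hence c0: "c \<ge> 0" using K by (simp add: mult_le_cancel_left1)
    consider "n \<ge> 1" | "n = 0" | "n \<le> -1" by linarith
    thus "tent K a c n t \<le> max (min (t - a) (c - t)) (t - a * K)"
    proof cases
      case 1
      have "K powi 1 \<le> K powi n" using K 1 by (intro power_int_increasing) auto
      hence "a * K \<le> a * K powi n" using a by (simp del: mult_le_cancel_left_pos)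
      thus ?thesis by (auto simp: tent_def)
    next
      case 3
      have "K powi n \<le> K powi (-1)" using K 3 by (intro power_int_increasing) auto
      hence "c * K powi n \<le> c / K" using mult_left_mono[OF _ c0] by (simp add: divide_inverse)
      moreover have "c / K \<le> 2 - a" using c K by (simp add: pos_divide_le_eq)
      moreover have "c / K \<le> c" using cK K by (simp add: pos_divide_le_eq)
      ultimately show ?thesis using t by (auto simp: tent_def)
    qed (auto simp: tent_def)
  qed
next
  have "2 * t \<le> (c + a) * K" using t c K mult_right_mono[of 2 "c + a" K] by linarith
  hence "tent K a c 1 t = t - a * K"
    by (auto simp: tent_def algebra_simps)
  moreover have "tent K a c 0 t = min (t - a) (c - t)"
    by (simp add: tent_def)
  ultimately show "max (min (t - a) (c - t)) (t - a * K) \<le> sawtooth K a c t"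
    using tent_le_sawtooth[of 0 t] tent_le_sawtooth[of 1 t] by auto
qed

end

text \<open>The interval from \<open>d / K\<close> to \<open>d\<close> meets every orbit of scaling
  by \<open>K\<close>, so one period suffices later.\<close>

lemma ex_scaled_representative:
  fixes K d z :: real
  assumes "K > 1" "d > 0" "z > 0"
  obtains n :: int and y where "z = K powi n * y" "d / K \<le> y" "y \<le> d"
proof
  define n where "n = \<lceil>log K (z / d)\<rceil>"
  have pow: "K powr real_of_int n = K powi n"
    using assms by (simp add: powr_real_of_int')
  have pos: "K powi n > 0" using assms by simp
  show "z = K powi n * (z / K powi n)" using pos assms by simp
  have "z / d \<le> K powr real_of_int n"
    using assms by (simp add: n_def flip: log_le_iff)
  thus "z / K powi n \<le> d"
    using assms pos by (simp add: pow pos_divide_le_eq mult.commute)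
  have "real_of_int n - 1 \<le> log K (z / d)"
    unfolding n_def by linarith
  hence "K powr (real_of_int n - 1) \<le> z / d"
    using assms by (simp add: powr_le_iff)
  hence "K powi n / K \<le> z / d"
    using assms by (simp add: powr_diff pow)
  thus "d / K \<le> z / K powi n"
    using assms pos by (simp add: field_simps)
qed

section \<open>The search trajectories\<close>

locale zigzag =
  fixes v :: real
  assumes v: "0 < v" "v < 1 / 3"
begin

text \<open>The ratio of consecutive turning times: going at unit speed from \<open>v\<close> at
  time 1, the other side of the cone is reached at \<open>-v * k\<close> at time
  \<open>k\<close>.\<close>

definition k :: real where "k = (1 + v) / (1 - v)"
definition c :: real where "c = (1 + 4 * v - v\<^sup>2) / (1 - v)"

text \<open>Two receiver turns make a period, hence the ratio \<open>k\<^sup>2\<close>. The lines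
  \<open>t - (1 - v)\<close> and \<open>1 + v - t\<close> of \<open>receiver\<close> cross at time 1
  and height \<open>v\<close>, its turning point. Both \<open>right\<close> and
  \<open>receiver\<close> have the same rising lines, which is how they travel together.\<close>

definition right :: "real \<Rightarrow> real" where "right = sawtooth (k\<^sup>2) (1 - v) c"
definition left :: "real \<Rightarrow> real" where "left t = - right (k * t) / k"
definition receiver :: "real \<Rightarrow> real" where "receiver = sawtooth (k\<^sup>2) (1 - v) (1 + v)"

section \<open>Algebra of the constants\<close>

lemma k_gt1: "k > 1"
  using v by (simp add: k_def)

lemma k2_gt1: "k\<^sup>2 > 1"
  using k_gt1 by (simp add: one_less_power)

lemma k_mult: "(1 - v) * k = 1 + v"
  using v by (simp add: k_def)

lemma k2_mult: "(1 - v) * k\<^sup>2 = (1 + v) * k"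
  using k_mult by (simp add: power2_eq_square flip: mult.assoc)

text \<open>The lines \<open>t - (1 - v)\<close> and \<open>c - t\<close> thus cross at time
  \<open>k\<close>: the right sender turns exactly when the receiver turns on the left.\<close>

lemma c_add: "c + (1 - v) = 2 * k"
  using v by (simp add: c_def k_def field_simps power2_eq_square)

lemma c_diff: "c - k = k - (1 - v)"
  using c_add by simp

text \<open>The margin is the term \<open>8 * v\<^sup>2\<close>. Geometrically, a sender meets the
  receiver no later than the receiver's next turn.\<close>

lemma c_le: "c \<le> (1 + v) * k\<^sup>2"
proof -
  have "(1 + 4 * v - v\<^sup>2) * (1 - v) + 8 * v\<^sup>2 = (1 + v) ^ 3"
    by algebra
  hence "(1 + 4 * v - v\<^sup>2) * (1 - v) / (1 - v)\<^sup>2 \<le> (1 + v) ^ 3 / (1 - v)\<^sup>2"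
    by (intro divide_right_mono) (use zero_le_power2[of v] in linarith, simp)
  also have "\<dots> = (1 + v) * k\<^sup>2"
    by (simp add: k_def power_divide power2_eq_square power3_eq_cube)
  finally show ?thesis
    using v by (simp add: c_def power2_eq_square)
qed

lemma c_diff_factor: "c - k = v * ((3 - v) * (1 - v)) / (1 - v)\<^sup>2"
proof -
  have "c - k = v * (3 - v) / (1 - v)"
    by (simp add: c_def k_def diff_divide_distrib[symmetric] power2_eq_square algebra_simps)
  thus ?thesis
    using v by (simp add: power2_eq_square)
qed

text \<open>The lower bound is where \<open>v < 1 / 3\<close> enters. It puts the sender's previous
  turning point \<open>(c - k) / k\<^sup>2\<close> no nearer than \<open>v\<close>, so new targets
  are found only from time 1 on, when sender and receiver part.\<close>

lemma c_diff_bounds: "v * k\<^sup>2 \<le> c - k" "c - k \<le> 3 * v * k\<^sup>2"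
proof -
  have "v * (1 + v)\<^sup>2 \<le> v * ((3 - v) * (1 - v))" "v * ((3 - v) * (1 - v)) \<le> v * (3 * (1 + v)\<^sup>2)"
    unfolding mult_le_cancel_left_pos[OF v(1)] using v by (auto simp: power2_eq_square algebra_simps)
  hence "v * (1 + v)\<^sup>2 / (1 - v)\<^sup>2 \<le> c - k" "c - k \<le> v * (3 * (1 + v)\<^sup>2) / (1 - v)\<^sup>2"
    unfolding c_diff_factor by (auto intro!: divide_right_mono)
  thus "v * k\<^sup>2 \<le> c - k" "c - k \<le> 3 * v * k\<^sup>2"
    by (auto simp: k_def power_divide mult.left_commute mult.commute)
qed

section \<open>The trajectories on one period and their symmetries\<close>

lemma right_period:
  assumes "1 \<le> t" "t \<le> k\<^sup>2"
  shows "right t = max (min (t - (1 - v)) (c - t)) (t - (1 - v) * k\<^sup>2)"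
proof -
  have "c + (1 - v) \<ge> 2" "c \<le> (2 - (1 - v)) * k\<^sup>2"
    using k_gt1 c_le unfolding c_add by auto
  thus ?thesis
    unfolding right_def using assms k2_gt1 v by (intro sawtooth_period) auto
qed

lemma receiver_period:
  assumes "1 \<le> t" "t \<le> k\<^sup>2"
  shows "receiver t = max (1 + v - t) (t - (1 - v) * k\<^sup>2)"
proof -
  have "1 + v \<le> (1 + v) * k\<^sup>2"
    using v k2_gt1 by simp
  hence "receiver t = max (min (t - (1 - v)) (1 + v - t)) (t - (1 - v) * k\<^sup>2)"
    unfolding receiver_def using assms k2_gt1 v by (intro sawtooth_period) auto
  thus ?thesis using assms by (simp add: min_def)
qed

lemma right_scale: "right ((k\<^sup>2) powi m * t) = (k\<^sup>2) powi m * right t"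
  unfolding right_def using k2_gt1 v by (intro sawtooth_scale) auto

lemma receiver_scale: "receiver ((k\<^sup>2) powi m * t) = (k\<^sup>2) powi m * receiver t"
  unfolding receiver_def using k2_gt1 v by (intro sawtooth_scale) auto

lemma left_scale: "left ((k\<^sup>2) powi m * t) = (k\<^sup>2) powi m * left t"
  using right_scale[of m "k * t"] by (simp add: left_def mult.left_commute)

lemma trajectory_right: "trajectory right"
  unfolding right_def using k2_gt1 v by (intro trajectory_sawtooth) auto

lemma trajectory_receiver: "trajectory receiver"
  unfolding receiver_def using k2_gt1 v by (intro trajectory_sawtooth) auto

lemma trajectory_left: "trajectory left"
proof -
  have "\<bar>left t - left s\<bar> \<le> t - s" if "0 \<le> s" "s \<le> t" for s t
  proof -
    have "\<bar>right (k * t) - right (k * s)\<bar> \<le> k * t - k * s"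
      using trajectory_right that k_gt1 by (auto simp: trajectory_iff)
    moreover have "left t - left s = - (right (k * t) - right (k * s)) / k"
      by (simp add: left_def diff_divide_distrib)
    ultimately show ?thesis
      using k_gt1 by (simp add: abs_mult pos_divide_le_eq right_diff_distrib mult.commute)
  qed
  moreover have "left 0 = 0"
    using trajectory_right by (simp add: left_def trajectory_iff)
  ultimately show ?thesis by (simp add: trajectory_iff)
qed

text \<open>The second equation is the half-period symmetry that later swaps the two
  senders.\<close>

lemma receiver_eq:
  assumes "1 \<le> t" "t \<le> k"
  shows "receiver t = 1 + v - t" "receiver (k * t) = - k * receiver t"
proof -
  have "k * 1 \<le> k * t" "k * t \<le> k * k"
    using k_gt1 assms by (auto simp del: mult_1_right)
  hence kt: "k \<le> k * t" "k * t \<le> k\<^sup>2"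
    by (auto simp: power2_eq_square)
  have "k \<le> k\<^sup>2"
    using k_gt1 by (simp add: power2_eq_square)
  have double: "1 + v + (1 - v) * k\<^sup>2 = 2 * k"
    using k_mult k2_mult by algebra
  thus 1: "receiver t = 1 + v - t"
    using receiver_period[of t] assms \<open>k \<le> k\<^sup>2\<close> by auto
  have "receiver (k * t) = k * t - (1 - v) * k\<^sup>2"
    using receiver_period[of "k * t"] kt k_gt1 double by linarith
  thus "receiver (k * t) = - k * receiver t"
    unfolding 1 k2_mult by (simp add: algebra_simps)
qed

text \<open>At time \<open>(1 + v + c / k) / 2\<close> the left sender, returning along \<open>t - c / k\<close>, meets the receiver,
  which moves along \<open>1 + v - t\<close>.\<close>

lemma left_eq_receiver:
  assumes "(1 + v + c / k) / 2 \<le> t" "1 \<le> t" "t \<le> k"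
  shows "left t = receiver t" "right (k * t) = receiver (k * t)"
proof -
  have "k * 1 \<le> k * t" "k * t \<le> k * k"
    using k_gt1 assms by (auto simp del: mult_1_right)
  hence kt: "k \<le> k * t" "k * t \<le> k\<^sup>2"
    by (auto simp: power2_eq_square)
  have "k * ((1 + v + c / k) / 2) \<le> k * t"
    using assms k_gt1 by (intro mult_left_mono) auto
  moreover have "k * ((1 + v + c / k) / 2) = ((1 + v) * k + c) / 2"
    using k_gt1 by (simp add: field_simps)
  ultimately have "c - k * t \<le> k * t - (1 - v) * k\<^sup>2"
    unfolding k2_mult by argo
  hence "right (k * t) = k * t - (1 - v) * k\<^sup>2"
    using right_period[of "k * t"] kt k_gt1 by (simp add: max_def min_def)
  moreover have "receiver (k * t) = k * t - (1 - v) * k\<^sup>2"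
    unfolding receiver_eq(2)[OF assms(2,3)] receiver_eq(1)[OF assms(2,3)] k2_mult
    by (simp add: algebra_simps)
  ultimately show "right (k * t) = receiver (k * t)" by simp
  thus "left t = receiver t"
    using receiver_eq(2)[OF assms(2,3)] k_gt1 by (simp add: left_def)
qed

section \<open>The delay ratio and the search plans\<close>

definition delay :: real where "delay = k * c / (c - k)"

lemma delay_eq: "delay = (1 + v) / (1 - v) * ((1 + 4 * v - v\<^sup>2) / (v * (3 - v)))"
proof -
  have "c - k = v * (3 - v) / (1 - v)"
    unfolding c_diff_factor using v by (simp add: power2_eq_square)
  thus ?thesis
    using v by (simp add: delay_def k_def c_def)
qed

lemma c_diff_pos: "c - k > 0"
  using c_diff k_gt1 v by simp

lemma delay_ge_2: "2 \<le> delay"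
proof -
  have "k * c - 2 * (c - k) = 2 * (k - 1)\<^sup>2 + (k - v) + v * (k - 1)"
    using c_diff by algebra
  also have "\<dots> \<ge> 0"
    using v k_gt1 by simp
  finally show ?thesis
    using c_diff_pos by (simp add: delay_def pos_le_divide_eq)
qed

text \<open>The right sender passes \<open>x\<close> at \<open>tf\<close>. From time
  \<open>s\<close> until \<open>k\<close> the left sender accompanies the receiver, so they are
  together at the later of \<open>tf\<close> and \<open>s\<close>. The equations at
  \<open>k * tm\<close> serve the mirrored case.\<close>

lemma search_period:
  assumes x: "(c - k) / k\<^sup>2 \<le> x" "x \<le> c - k"
  obtains tf tm where "0 \<le> tf" "tf \<le> tm" "right tf = x" "receiver (k * tm) = - k * receiver tm"
    "left tm = receiver tm" "right (k * tm) = receiver (k * tm)" "tm + \<bar>x - receiver tm\<bar> \<le> (1 + delay) * x"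
proof -
  define tf where "tf = 1 - v + x"
  define s where "s = (1 + v + c / k) / 2"
  define tm where "tm = max tf s"
  have k0: "k > 0" using k_gt1 by simp
  have "v \<le> (c - k) / k\<^sup>2"
    using c_diff_bounds k0 by (simp add: pos_le_divide_eq)
  hence tf: "1 \<le> tf" "tf \<le> k" "v \<le> x"
    using x c_diff by (auto simp: tf_def)
  have "k \<le> k\<^sup>2"
    using k_gt1 by (simp add: power2_eq_square)
  hence right_tf: "right tf = x"
  proof -
    have "(1 - v) * 1 \<le> (1 - v) * k\<^sup>2"
      using v k2_gt1 by (intro mult_left_mono) auto
    moreover have "tf - (1 - v) \<le> c - tf"
      using tf c_add by linarith
    ultimately show ?thesis
      using right_period[of tf] tf \<open>k \<le> k\<^sup>2\<close> by (simp add: tf_def)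
  qed
  have "c / k \<le> (1 + v) * k"
    using c_le k0 by (simp add: pos_divide_le_eq power2_eq_square mult.assoc)
  moreover have "1 + v = 2 * k - (1 + v) * k"
    using k_mult by (simp add: algebra_simps)
  ultimately have "1 + v + c / k \<le> 2 * k"
    by argo
  hence "s \<le> k"
    by (simp add: s_def)
  hence tm: "1 \<le> tm" "tm \<le> k" "s \<le> tm"
    using tf by (auto simp: tm_def)
  have rec: "receiver tm = 1 + v - tm"
    using tm receiver_eq by blast
  have "delay * ((c - k) / k\<^sup>2) \<le> delay * x"
    using x c_diff_pos k0 c_add by (intro mult_left_mono) (auto simp: delay_def)
  moreover have "delay * ((c - k) / k\<^sup>2) = c / k"
    using c_diff_pos k0 by (simp add: delay_def power2_eq_square)
  ultimately have x': "c / k \<le> delay * x" by simp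
  \<comment> \<open>The total time is \<open>tm + (x - (1 + v - tm))\<close>, so this is the excess
    over \<open>x\<close>.\<close>
  have "2 * tm - (1 + v) \<le> delay * x"
  proof (cases "tf \<le> s")
    case True
    hence "2 * tm = 1 + v + c / k" by (simp add: tm_def s_def)
    thus ?thesis using x' by linarith
  next
    case False
    \<comment> \<open>For \<open>tm = tf\<close> the excess is \<open>2 * x + 1 - 3 * v\<close>.
      Since \<open>delay >= 2\<close>, its slope is at most that of \<open>delay * x\<close>, and it
      suffices to compare at the left end \<open>(c - k) / k\<^sup>2\<close>.\<close>
    have "(2 - k) * (c - k) \<le> 1 * (c - k)"
      using k_gt1 c_diff_pos by (intro mult_right_mono) auto
    hence "(2 - k) * (c - k) / k\<^sup>2 \<le> 3 * v"
      using c_diff_bounds k0 by (simp add: pos_divide_le_eq)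
    moreover have "(2 - k) * (c - k) / k\<^sup>2 = 2 * ((c - k) / k\<^sup>2) - c / k + 1"
      using k0 by (simp add: field_simps power2_eq_square)
    ultimately have "1 - 3 * v \<le> (delay - 2) * ((c - k) / k\<^sup>2)"
      using \<open>delay * ((c - k) / k\<^sup>2) = c / k\<close> by (simp only: left_diff_distrib)
    also have "\<dots> \<le> (delay - 2) * x"
      using x delay_ge_2 by (intro mult_left_mono) auto
    finally show ?thesis using False by (simp add: tm_def tf_def left_diff_distrib)
  qed
  \<comment> \<open>From \<open>tm >= tf\<close> and \<open>v <= x\<close>; it resolves the absolute
    value.\<close>
  moreover have "1 + v - tm \<le> x" using tf tm by (simp add: tm_def)
  ultimately have "tm + \<bar>x - receiver tm\<bar> \<le> (1 + delay) * x"
    by (simp add: rec algebra_simps)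
  thus ?thesis
    using that[of tf tm] tf tm right_tf receiver_eq(2)[OF tm(1,2)] left_eq_receiver[of tm]
    by (auto simp: s_def tm_def)
qed

text \<open>A search plan on the right half-line gives one on the left half-line, by scaling with \<open>- k\<close>.\<close>

lemma search_plan:
  assumes "x \<noteq> 0"
  shows "\<exists>tf tm. 0 \<le> tf \<and> tf \<le> tm \<and>
    (right tf = x \<and> left tm = receiver tm \<or> left tf = x \<and> right tm = receiver tm) \<and>
    tm + \<bar>x - receiver tm\<bar> \<le> (1 + delay) * \<bar>x\<bar>"
proof -
  have k0: "k > 0" using k_gt1 by simp
  define z where "z = (if x > 0 then x else - x / k)"
  have "z > 0" using assms k0 by (auto simp: z_def divide_less_0_iff)
  then obtain n :: int and y where y: "z = (k\<^sup>2) powi n * y" "(c - k) / k\<^sup>2 \<le> y" "y \<le> c - k"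
    using ex_scaled_representative[OF k2_gt1 c_diff_pos] by metis
  define K where "K = (k\<^sup>2) powi n"
  have K: "K > 0" using k0 by (simp add: K_def)
  note scale = right_scale[of n, folded K_def] left_scale[of n, folded K_def]
    receiver_scale[of n, folded K_def]
  from y(2,3) obtain tf tm where plan: "0 \<le> tf" "tf \<le> tm" "right tf = y"
    "receiver (k * tm) = - k * receiver tm" "left tm = receiver tm"
    "right (k * tm) = receiver (k * tm)" "tm + \<bar>y - receiver tm\<bar> \<le> (1 + delay) * y"
    by (rule search_period)
  show ?thesis
  proof (cases "x > 0")
    case True
    hence x: "x = K * y" using y by (simp add: z_def K_def)
    have "K * (tm + \<bar>y - receiver tm\<bar>) \<le> K * ((1 + delay) * y)"
      using plan K by (intro mult_left_mono) auto
    moreover have "\<bar>K * y - K * receiver tm\<bar> = K * \<bar>y - receiver tm\<bar>"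
      using K by (simp add: abs_mult flip: right_diff_distrib)
    ultimately have "K * tm + \<bar>x - receiver (K * tm)\<bar> \<le> (1 + delay) * \<bar>x\<bar>"
      using True unfolding scale x by (simp add: distrib_left mult.left_commute)
    moreover have "right (K * tf) = x" "left (K * tm) = receiver (K * tm)"
      by (simp_all add: scale plan x)
    ultimately show ?thesis
      using plan(1,2) K by (intro exI[of _ "K * tf"] exI[of _ "K * tm"]) auto
  next
    case False
    hence x: "x = K * (- k * y)" using y k0 by (simp add: z_def K_def field_simps)
    \<comment> \<open>An odd power of \<open>k\<close>: scaling by it mirrors the picture and
      exchanges the senders.\<close>
    define L where "L = K * k"
    have L: "L > 0" using K k0 by (simp add: L_def)
    have rec: "receiver (L * tm) = - L * receiver tm"
      using scale(3)[of "k * tm"] plan(4) by (simp add: L_def mult.assoc)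
    have "L * (tm + \<bar>y - receiver tm\<bar>) \<le> L * ((1 + delay) * y)"
      using plan L by (intro mult_left_mono) auto
    moreover have "\<bar>x - receiver (L * tm)\<bar> = L * \<bar>y - receiver tm\<bar>"
    proof -
      have "x - receiver (L * tm) = - (L * (y - receiver tm))"
        unfolding rec x by (simp add: L_def algebra_simps)
      thus ?thesis using L by (simp add: abs_mult)
    qed
    moreover have "\<bar>x\<bar> = L * y"
      using False unfolding x by (simp add: L_def mult.assoc)
    ultimately have "L * tm + \<bar>x - receiver (L * tm)\<bar> \<le> (1 + delay) * \<bar>x\<bar>"
      by (simp add: distrib_left mult.left_commute)
    moreover have "left (L * tf) = x"
    proof -
      have "right (k * (k * tf)) = k\<^sup>2 * y"
        using right_scale[of 1 tf] plan(3) by (simp add: power2_eq_square mult.assoc)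
      hence "left (k * tf) = - k * y"
        using k0 by (simp add: left_def power2_eq_square)
      thus ?thesis using scale(2)[of "k * tf"] by (simp add: L_def x mult.assoc)
    qed
    moreover have "right (L * tm) = receiver (L * tm)"
      using scale(1,3)[of "k * tm"] plan(6) by (simp add: L_def mult.assoc)
    ultimately show ?thesis
      using plan(1,2) L by (intro exI[of _ "L * tf"] exI[of _ "L * tm"]) auto
  qed
qed

theorem evacuation_zigzag:
  assumes "ns \<ge> 2"
  shows "\<exists>A. evacuation_algorithm ns 1 A \<and> competitive_ratio ns 1 A \<le> ereal (1 + delay)"
proof (rule evacuation_from_search)
  \<comment> \<open>Sender 0 goes left and all others go right; \<open>ns >= 2\<close> ensures that
    sender 1 exists.\<close>
  define p where "p i = (if i = 0 then left else if i < ns then right else receiver)" for i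
  show "trajectory (p i)" for i
    by (simp add: p_def trajectory_left trajectory_right trajectory_receiver)
  fix x :: real assume "\<bar>x\<bar> > 1"
  hence "x \<noteq> 0" by auto
  from search_plan[OF this] obtain tf tm where plan: "0 \<le> tf" "tf \<le> tm"
    "right tf = x \<and> left tm = receiver tm \<or> left tf = x \<and> right tm = receiver tm"
    "tm + \<bar>x - receiver tm\<bar> \<le> (1 + delay) * \<bar>x\<bar>"
    by blast
  have p: "p 0 = left" "p 1 = right" "p ns = receiver" "\<And>i. i < ns \<Longrightarrow> p i = left \<or> p i = right"
    "0 < ns" "1 < ns"
    using assms by (auto simp: p_def)
  have "\<exists>j<ns. p j tf = x"
    using plan(3) p(1,2,5,6) by metis
  moreover have "\<forall>i<ns. p i tf = x \<or> p i tm = p ns tm"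
    using plan(3) p(3,4) by metis
  ultimately show "\<exists>tf tm. 0 \<le> tf \<and> tf \<le> tm \<and> (\<exists>j<ns. p j tf = x) \<and>
      (\<forall>i<ns. p i tf = x \<or> p i tm = p ns tm) \<and> tm + \<bar>x - p ns tm\<bar> \<le> (1 + delay) * \<bar>x\<bar>"
    using plan p(3) by metis
qed

end

section \<open>The optimal cone\<close>

definition quartic :: "real \<Rightarrow> real" where
  "quartic v = v ^ 4 - 16 * v ^ 3 + 26 * v\<^sup>2 + 8 * v - 3"

lemma is_vr_iff: "is_vr v \<longleftrightarrow> 0 \<le> v \<and> v < 1 \<and> quartic v = 0"
  by (simp add: is_vr_def quartic_def)

lemma quartic_strict_mono:
  assumes "0 \<le> a" "a < b" "b \<le> 1"
  shows "quartic a < quartic b"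
proof (rule DERIV_pos_imp_increasing_open[OF assms(2)])
  fix x assume x: "a < x" "x < b"
  have "(quartic has_real_derivative 4 * x ^ 3 - 48 * x\<^sup>2 + 52 * x + 8) (at x)"
    unfolding quartic_def by (auto intro!: derivative_eq_intros)
  \<comment> \<open>The derivative regrouped so that every term is nonnegative on the unit
    interval.\<close>
  moreover have "4 * x ^ 3 + 48 * (x * (1 - x)) + 4 * x + 8 > 0"
    using x assms by (intro add_nonneg_pos add_nonneg_nonneg mult_nonneg_nonneg) auto
  hence "4 * x ^ 3 - 48 * x\<^sup>2 + 52 * x + 8 > 0"
    by (simp add: power2_eq_square algebra_simps)
  ultimately show "\<exists>y. (quartic has_real_derivative y) (at x) \<and> 0 < y" by blast
qed (auto simp: quartic_def intro!: continuous_intros)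

lemma ex1_vr: "\<exists>!v. is_vr v"
  and vr_bounds: "is_vr v \<Longrightarrow> 0.2286516921 \<le> v \<and> v \<le> 0.2286516922"
proof -
  have sgn: "quartic 0.2286516921 < 0" "0 < quartic 0.2286516922"
    by (simp_all add: quartic_def power_divide)
  have "\<exists>v\<ge>0.2286516921. v \<le> 0.2286516922 \<and> quartic v = 0"
    using sgn by (intro IVT') (auto simp: quartic_def intro!: continuous_intros)
  then obtain v where v: "0.2286516921 \<le> v" "v \<le> 0.2286516922" "quartic v = 0"
    by blast
  have unique: "w = v" if "is_vr w" for w
    using quartic_strict_mono[of v w] quartic_strict_mono[of w v] that v
    unfolding is_vr_iff by (cases w v rule: linorder_cases) auto
  have "is_vr v" using v by (simp add: is_vr_iff)
  thus "\<exists>!v. is_vr v" using unique by blast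
  show "0.2286516921 \<le> v \<and> v \<le> 0.2286516922" if "is_vr v" for v
    using unique v that by metis
qed

lemma delay_bound:
  fixes v :: real
  assumes "0.2286516921 \<le> v" "v \<le> 0.2286516922"
  shows "(1 + v) / (1 - v) * ((1 + 4 * v - v\<^sup>2) / (v * (3 - v))) < 4.681319"
proof -
  define a b :: real where "a = 0.2286516921" and "b = 0.2286516922"
  have v: "0 < a" "a \<le> v" "v \<le> b" "b < 1" using assms by (auto simp: a_def b_def)
  have "a\<^sup>2 \<le> v\<^sup>2" using v by (intro power_mono) auto
  \<comment> \<open>Each occurrence of \<open>v\<close> is bounded separately by the endpoint that
    enlarges the value; the width \<open>10^-10\<close> of the interval keeps the loss small
    enough.\<close>
  have "(1 + v) / (1 - v) * ((1 + 4 * v - v\<^sup>2) / (v * (3 - v)))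
      \<le> (1 + b) / (1 - b) * ((1 + 4 * b - a\<^sup>2) / (a * (3 - b)))"
  proof (intro mult_mono frac_le)
    show "0 \<le> 1 + 4 * b - a\<^sup>2" by (simp add: a_def b_def power_divide)
    show "0 \<le> (1 + 4 * v - v\<^sup>2) / (v * (3 - v))"
      using v power_le_one[of v 2] by (intro divide_nonneg_pos mult_pos_pos) auto
    show "1 + 4 * v - v\<^sup>2 \<le> 1 + 4 * b - a\<^sup>2"
      using v \<open>a\<^sup>2 \<le> v\<^sup>2\<close> by linarith
  qed (use v in auto)
  also have "\<dots> < 4.681319" by (simp add: a_def b_def power_divide)
  finally show ?thesis .
qed

theorem theorem3:
  fixes ns :: nat
  assumes "ns \<ge> 2"
  shows "(\<exists>!v. is_vr v) \<and>
    (\<exists>A. evacuation_algorithm ns 1 A \<and>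
      competitive_ratio ns 1 A < ereal 5.681319 \<and>
      (\<forall>v. is_vr v \<longrightarrow> competitive_ratio ns 1 A \<le>
        ereal (1 + (1 + v) / (1 - v) * ((1 + 4 * v - v^2) / (v * (3 - v))))))"
proof (intro conjI)
  show "\<exists>!v. is_vr v" by (rule ex1_vr)
  then obtain v where vr: "is_vr v" "\<And>w. is_vr w \<Longrightarrow> w = v" by blast
  note bounds = vr_bounds[OF vr(1)]
  interpret zigzag v
    by unfold_locales (use bounds in auto)
  obtain A where A: "evacuation_algorithm ns 1 A" "competitive_ratio ns 1 A \<le> ereal (1 + delay)"
    using evacuation_zigzag[OF assms] by blast
  have "ereal (1 + delay) < ereal 5.681319"
    using delay_bound[of v] bounds by (simp add: delay_eq)
  with A(2) have lt: "competitive_ratio ns 1 A < ereal 5.681319"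
    by (rule le_less_trans)
  show "\<exists>A. evacuation_algorithm ns 1 A \<and>
      competitive_ratio ns 1 A < ereal 5.681319 \<and>
      (\<forall>v. is_vr v \<longrightarrow> competitive_ratio ns 1 A \<le>
        ereal (1 + (1 + v) / (1 - v) * ((1 + 4 * v - v^2) / (v * (3 - v)))))"
  proof (intro exI[of _ A] conjI allI impI A(1) lt)
    \<comment> \<open>The algorithm was built from \<open>v\<close>, so uniqueness of the root is
      what covers every \<open>w\<close>.\<close>
    fix w assume "is_vr w"
    hence "w = v" by (rule vr(2))
    thus "competitive_ratio ns 1 A \<le> ereal (1 + (1 + w) / (1 - w) * ((1 + 4 * w - w^2) / (w * (3 - w))))"
      using A(2) by (simp only: delay_eq)
  qed
qed

end
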